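(* Let $\mathbb{T}=\mathbb{R}/\mathbb{Z}$, $a=1/2$, fix $0<\rho<1/20$, and let $\omega(r):=\sin(\log\log(1/r))$ for $0<r<\rho$. Let $A\neq 0$ satisfy $2|A|\rho^2\le 1/4$. Let $V\in C^3(\mathbb{T})$ satisfy $V(x)=\tfrac12 x^2+Ax^4\omega(|x|)$ for $|x|<\rho$ (with $V(0)=0$), $V(x)=\tfrac12(x-a)^2-A(x-a)^4\omega(|x-a|)$ for $|x-a|<\rho$ (with $V(a)=0$), and $V(x)>0$ for all $x\in\mathbb{T}\setminus\{0,a\}$. Set $F:=-V$. For $\varepsilon\in(0,1)$, let $c(\varepsilon)\in\mathbb{R}$ be the unique constant for which the ergodic problem $$\tfrac12|(\phi^\varepsilon)'|^2+F(x)-\varepsilon(\phi^\varepsilon)''=c(\varepsilon)\quad\text{on }\mathbb{T}$$ admits a solution, and let $\phi^\varepsilon$ be the unique solution normalized by $\phi^\varepsilon(0)=0$. Then the family $\{\phi^\varepsilon\}_{\varepsilon\in(0,1)}$ does not converge in $C(\mathbb{T})$ as $\varepsilon\to0$.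
   Context: Periodic functions on $\mathbb{R}$ are identified with functions on $\mathbb{T}$; intervals are understood in the periodic sense. The solution $\phi^\varepsilon$ is unique up to an additive constant, which is fixed by $\phi^\varepsilon(0)=0$. *)

theory Defs
  imports "HOL-Analysis.Analysis"
begin

definition omega :: "real \<Rightarrow> real" where
  "omega r = sin (ln (ln (1 / r)))"

text \<open>Functions on the torus R/Z are identified with 1-periodic functions on R.\<close>
definition periodic1 :: "(real \<Rightarrow> real) \<Rightarrow> bool" where
  "periodic1 f \<longleftrightarrow> (\<forall>x. f (x + 1) = f x)"

end

theory Submission
  imports Defs "HOL-Real_Asymp.Real_Asymp"
begin

text \<open>Put \<open>p = \<phi>'\<close> and \<open>E = - c(\<epsilon>)\<close>, so that \<open>\<epsilon> p' = p\<^sup>2 / 2 - V + E\<close>; then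
  \<open>exp (- \<phi> / (2 \<epsilon>))\<close> is the ground state of \<open>- 2 \<epsilon>\<^sup>2 u'' + V u\<close>, with energy \<open>E\<close>. A Gaussian
  of variance of order \<open>\<epsilon>\<close> placed in the wells \<open>0\<close> and \<open>1/2\<close> has energies
  \<open>\<epsilon> + 3 A \<epsilon>\<^sup>2 omega (sqrt \<epsilon>)\<close> and \<open>\<epsilon> - 3 A \<epsilon>\<^sup>2 omega (sqrt \<epsilon>)\<close> to leading order. As \<open>omega\<close>
  oscillates very slowly, there are arbitrarily small \<open>\<epsilon>\<close> for which it keeps a prescribed sign on
  all scales between \<open>\<epsilon>\<close> and \<open>\<epsilon>\<^bsup>1/5\<^esup>\<close>, and then one chosen well is favoured by a gap of
  order \<open>\<epsilon>\<^sup>2\<close>. For such \<open>\<epsilon>\<close> the ground state cannot be localised at the other well, i.e. a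
  uniform limit \<open>g\<close> of \<open>\<phi>\<close> has no strict local minimum there. On the other hand \<open>g\<close> has no local
  minimum where \<open>V > 0\<close>, so \<open>g\<close> is strictly smaller at the favoured well than at the other one.
  Since either well can be chosen, this is contradictory.\<close>

section \<open>Calculus on an interval and periodic functions\<close>

lemma deriv_ge_increment:
  fixes G :: "real \<Rightarrow> real"
  assumes "a \<le> b" and "\<And>x. a \<le> x \<Longrightarrow> x \<le> b \<Longrightarrow> (G has_real_derivative d x) (at x)"
    and "\<And>x. a \<le> x \<Longrightarrow> x \<le> b \<Longrightarrow> k \<le> d x"
  shows "k * (b - a) \<le> G b - G a"
proof -
  have "G a - k * a \<le> G b - k * b"
  proof (rule DERIV_nonneg_imp_nondecreasing[OF assms(1)])
    fix x assume x: "a \<le> x" "x \<le> b"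
    have "((\<lambda>x. G x - k * x) has_real_derivative (d x - k)) (at x)"
      by (auto intro!: derivative_eq_intros assms(2) x)
    then show "\<exists>y. ((\<lambda>x. G x - k * x) has_real_derivative y) (at x) \<and> 0 \<le> y"
      using assms(3)[OF x] by (intro exI[of _ "d x - k"]) auto
  qed
  then show ?thesis by (simp add: algebra_simps)
qed

lemma deriv_le_increment:
  fixes G :: "real \<Rightarrow> real"
  assumes "a \<le> b" and "\<And>x. a \<le> x \<Longrightarrow> x \<le> b \<Longrightarrow> (G has_real_derivative d x) (at x)"
    and "\<And>x. a \<le> x \<Longrightarrow> x \<le> b \<Longrightarrow> d x \<le> k"
  shows "G b - G a \<le> k * (b - a)"
proof -
  have "- k * (b - a) \<le> - G b - (- G a)"
    by (rule deriv_ge_increment[where d = "\<lambda>x. - d x"])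
       (use assms in \<open>auto intro!: derivative_eq_intros\<close>)
  then show ?thesis by (simp add: algebra_simps)
qed

lemma second_derivative_at_interior_min:
  fixes f :: "real \<Rightarrow> real"
  assumes f1: "\<And>x. (f has_real_derivative f' x) (at x)"
    and f2: "(f' has_real_derivative D) (at t)"
    and t: "x < t" "t < z" and min: "\<And>y. x \<le> y \<Longrightarrow> y \<le> z \<Longrightarrow> f t \<le> f y"
  shows "f' t = 0" "0 \<le> D"
proof -
  show 0: "f' t = 0"
  proof (rule DERIV_local_min[OF f1])
    show "0 < min (t - x) (z - t)" using t by simp
    show "\<forall>y. \<bar>t - y\<bar> < min (t - x) (z - t) \<longrightarrow> f t \<le> f y"
      by (auto intro!: min)
  qed
  show "0 \<le> D"
  proof (rule ccontr)
    assume "\<not> 0 \<le> D"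
    then obtain d where d: "d > 0" "\<And>h. h > 0 \<Longrightarrow> h < d \<Longrightarrow> f' (t + h) < f' t"
      using DERIV_neg_dec_right[OF f2] by auto
    define h where "h = min (d / 2) (z - t)"
    have h: "0 < h" "h < d" "t + h \<le> z" using d t by (auto simp: h_def)
    obtain w where w: "t < w" "w < t + h" "f (t + h) - f t = (t + h - t) * f' w"
      using MVT2[of t "t + h" f f'] f1 h by auto
    have "f' w < 0" using d(2)[of "w - t"] w h 0 by simp
    then have "h * f' w < 0" using h by (simp add: mult_pos_neg)
    then show False using w(3) min[of "t + h"] h t by simp
  qed
qed

lemma periodic1_add_of_int:
  assumes "periodic1 f"
  shows "f (x + of_int k) = f x"
proof -
  have nat: "f (x + of_nat n) = f x" for x n
  proof (induction n)
    case (Suc n)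
    have "f (x + of_nat (Suc n)) = f ((x + of_nat n) + 1)" by (simp add: algebra_simps)
    then show ?case using assms Suc by (simp add: periodic1_def)
  qed simp
  show ?thesis
  proof (cases "k \<ge> 0")
    case True
    then show ?thesis using nat[of x "nat k"] by simp
  next
    case False
    then show ?thesis using nat[of "x + of_int k" "nat (- k)"] by simp
  qed
qed

lemma periodic1_attains_sup:
  assumes per: "periodic1 f" and cont: "continuous_on UNIV f"
  shows "\<exists>x. \<forall>y. f y \<le> f x"
proof -
  obtain x where x: "\<forall>y\<in>{0..1}. f y \<le> f x"
    using continuous_attains_sup[of "{0..1::real}" f] continuous_on_subset[OF cont] by auto
  have "f y \<le> f x" for y
  proof -
    have "f y = f (frac y)"
      using periodic1_add_of_int[OF per, of "frac y" "\<lfloor>y\<rfloor>"] by (simp add: frac_def)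
    then show ?thesis using x frac_lt_1[of y] frac_ge_0[of y] by auto
  qed
  then show ?thesis by blast
qed

section \<open>The slow oscillation of \<open>omega\<close>\<close>

lemma omega_bounded: "\<bar>omega r\<bar> \<le> 1"
  by (simp add: omega_def)

text \<open>With \<open>L = ln (1 / \<epsilon>)\<close>, the range of \<open>r\<close> puts
  \<open>ln (1 / r)\<close> in \<open>[L / 5, L]\<close>, so \<open>ln (ln (1 / r))\<close> differs
  from \<open>ln (L / 2)\<close> by some \<open>t\<close> with \<open>\<bar>t\<bar> \<le> 1\<close>.
  At \<open>ln (L / 2)\<close> the sine is extremal, hence
  \<open>\<sigma> * omega r = cos t\<close>, which stays above 1/2.\<close>

lemma omega_resonant:
  assumes eps: "0 < \<epsilon>" "\<epsilon> < 1" and res: "sin (ln (ln (1 / \<epsilon>) / 2)) = \<sigma>" and \<sigma>: "\<sigma>\<^sup>2 = 1"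
    and r: "\<epsilon> \<le> r" "r \<le> \<epsilon> powr (1/5)"
  shows "1 / 2 \<le> \<sigma> * omega r"
proof -
  define L where "L = ln (1 / \<epsilon>)"
  define l where "l = ln (1 / r)"
  define t where "t = ln (2 * l / L)"
  have rpos: "0 < r" using eps r by simp
  have L: "0 < L" using eps by (simp add: L_def ln_div)
  have "ln r \<le> ln (\<epsilon> powr (1/5))" using r rpos by (subst ln_le_cancel_iff) auto
  also have "\<dots> = - L / 5" using eps by (simp add: ln_powr L_def ln_div)
  finally have l1: "L / 5 \<le> l" using rpos by (simp add: l_def ln_div)
  have "ln \<epsilon> \<le> ln r" using r rpos eps by (subst ln_le_cancel_iff) auto
  then have l2: "l \<le> L" using rpos eps by (simp add: l_def L_def ln_div)
  have lpos: "0 < l" using l1 L by linarith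
  have e1: "5 / 2 \<le> exp (1::real)" using exp_lower_Taylor_quadratic[of 1] by simp
  have q: "2 / 5 \<le> 2 * l / L" "2 * l / L \<le> 2" using l1 l2 L by (simp_all add: field_simps)
  have t1: "t \<le> 1"
  proof -
    have "2 * l / L \<le> exp 1" using q e1 by linarith
    then have "ln (2 * l / L) \<le> ln (exp 1)" using lpos L by (subst ln_le_cancel_iff) auto
    then show ?thesis by (simp add: t_def)
  qed
  have t2: "- 1 \<le> t"
  proof -
    have "exp (- 1) \<le> 2 / (5::real)" using e1 by (simp add: exp_minus field_simps)
    then have "exp (- 1) \<le> 2 * l / L" using q by linarith
    then have "ln (exp (- 1)) \<le> ln (2 * l / L)" using lpos L by (subst ln_le_cancel_iff) auto
    then show ?thesis by (simp add: t_def)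
  qed
  have "ln l = ln (L / 2) + t"
    using lpos L by (simp add: t_def ln_div ln_mult)
  then have om: "omega r = sin (ln (L / 2) + t)" by (simp add: omega_def l_def)
  have s: "sin (ln (L / 2)) = \<sigma>" using res by (simp add: L_def)
  have "(cos (ln (L / 2)))\<^sup>2 = 0" using sin_cos_squared_add[of "ln (L / 2)"] s \<sigma> by simp
  then have "omega r = \<sigma> * cos t" using om s by (simp add: sin_add)
  then have "\<sigma> * omega r = \<sigma>\<^sup>2 * cos t" by (simp add: power2_eq_square)
  then have eq: "\<sigma> * omega r = cos t" using \<sigma> by simp
  have "cos t = 1 - 2 * (sin (t / 2))\<^sup>2" using cos_double_sin[of "t / 2"] by simp
  moreover have "(sin (t / 2))\<^sup>2 \<le> (1 / 2)\<^sup>2"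
  proof -
    have "\<bar>sin (t / 2)\<bar> \<le> \<bar>t / 2\<bar>" by (rule abs_sin_x_le_abs_x)
    also have "\<dots> \<le> 1 / 2" using t1 t2 by (simp add: abs_le_iff)
    finally have "\<bar>sin (t / 2)\<bar>\<^sup>2 \<le> (1 / 2)\<^sup>2" by (intro power_mono) auto
    then show ?thesis by simp
  qed
  ultimately show ?thesis using eq by (simp add: power2_eq_square)
qed

lemma frequently_resonant:
  assumes "\<sigma> = 1 \<or> \<sigma> = (- 1 :: real)"
  shows "\<exists>\<^sub>F \<epsilon> in at_right 0. sin (ln (ln (1 / \<epsilon>) / 2)) = \<sigma>"
proof -
  \<comment> \<open>These values solve \<open>ln (ln (1 / \<epsilon>) / 2) = \<sigma> * pi / 2 + 2 *
    pi * n\<close> for \<epsilon>.\<close>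
  define \<epsilon>s where "\<epsilon>s = (\<lambda>n::nat. exp (- 2 * exp (\<sigma> * (pi / 2) + 2 * pi * real n)))"
  have s: "sin (ln (ln (1 / \<epsilon>s n) / 2)) = \<sigma>" for n
  proof -
    have "ln (ln (1 / \<epsilon>s n) / 2) = \<sigma> * (pi / 2) + real n * (2 * pi)"
      by (simp add: \<epsilon>s_def ln_div)
    moreover have "sin (\<sigma> * (pi / 2) + real n * (2 * pi)) = \<sigma>"
      using assms cos_2npi[of n] sin_2npi[of n] by (auto simp: sin_add mult_ac)
    ultimately show ?thesis by simp
  qed
  have lim: "filterlim \<epsilon>s (at_right 0) sequentially"
    unfolding \<epsilon>s_def using assms by (elim disjE; hypsubst; real_asymp)
  have "\<exists>\<^sub>F n in sequentially. sin (ln (ln (1 / \<epsilon>s n) / 2)) = \<sigma>"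
    by (simp add: s frequently_const_iff)
  then show ?thesis using lim
    by (auto simp: frequently_def filterlim_iff)
qed

section \<open>The Riccati equation at a fixed viscosity\<close>

locale viscous_hj =
  fixes V \<phi> p p' :: "real \<Rightarrow> real" and \<epsilon> E :: real
  assumes eps: "0 < \<epsilon>" "\<epsilon> < 1"
    and d1: "\<And>x. (\<phi> has_real_derivative p x) (at x)"
    and d2: "\<And>x. (p has_real_derivative p' x) (at x)"
    and riccati: "\<And>x. \<epsilon> * p' x = (p x)\<^sup>2 / 2 - V x + E"
begin

text \<open>The perturbed function \<phi> + \<eta> (t - y)^2 is smaller at \<open>y\<close> than at
  both ends, so it has an interior minimum; the first and second order conditions there are inserted
  into the Riccati equation. The case \<eta> = 0 treats minima of \<phi> itself, while \<eta> > 0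
  leaves room for small errors in the comparison with the ends.\<close>

lemma interior_min:
  assumes xyz: "x < y" "y < z" and "0 \<le> \<eta>"
    and lx: "\<phi> y < \<phi> x + \<eta> * (x - y)\<^sup>2" and lz: "\<phi> y < \<phi> z + \<eta> * (z - y)\<^sup>2"
  shows "\<exists>t. x < t \<and> t < z \<and> V t \<le> 2 * \<eta>\<^sup>2 * (t - y)\<^sup>2 + E + 2 * \<eta> * \<epsilon>"
proof -
  define f where "f = (\<lambda>t. \<phi> t + \<eta> * (t - y)\<^sup>2)"
  define f' where "f' = (\<lambda>t. p t + 2 * \<eta> * (t - y))"
  have f1: "(f has_real_derivative f' t) (at t)" for t
    unfolding f_def f'_def by (auto intro!: derivative_eq_intros d1)
  have f2: "(f' has_real_derivative (p' t + 2 * \<eta>)) (at t)" for t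
    unfolding f'_def by (auto intro!: derivative_eq_intros d2)
  have "continuous_on {x..z} f"
    by (intro continuous_at_imp_continuous_on ballI DERIV_isCont[OF f1])
  then obtain t where t: "t \<in> {x..z}" "\<forall>w\<in>{x..z}. f t \<le> f w"
    using continuous_attains_inf[of "{x..z}" f] xyz by auto
  have "f t \<le> f y" using t xyz by auto
  moreover have "f y < f x" "f y < f z" using lx lz by (auto simp: f_def)
  ultimately have "t \<noteq> x" "t \<noteq> z" by auto
  then have tt: "x < t" "t < z" using t by auto
  have "f' t = 0" "0 \<le> p' t + 2 * \<eta>"
    using second_derivative_at_interior_min[OF f1 f2 tt] t by auto
  then have "p t = - (2 * \<eta> * (t - y))" and h: "- (2 * \<eta>) \<le> p' t" by (auto simp: f'_def)
  then have "(p t)\<^sup>2 / 2 = 2 * \<eta>\<^sup>2 * (t - y)\<^sup>2" by (simp add: power2_eq_square)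
  moreover have "\<epsilon> * (- (2 * \<eta>)) \<le> \<epsilon> * p' t" using h eps by (intro mult_left_mono) auto
  ultimately show ?thesis using riccati[of t] tt by (intro exI[of _ t]) (auto simp: mult_ac)
qed

text \<open>At a global minimum of \<phi>, \<open>p\<close> vanishes and \<open>p'\<close> is
  nonnegative, so the Riccati equation gives \<open>E \<ge> V\<close>.\<close>

lemma energy_nonneg:
  assumes "periodic1 \<phi>" and "\<And>x. 0 \<le> V x"
  shows "0 \<le> E"
proof -
  have "continuous_on UNIV (\<lambda>x. - \<phi> x)"
    by (intro continuous_at_imp_continuous_on ballI continuous_minus DERIV_isCont[OF d1])
  moreover have "periodic1 (\<lambda>x. - \<phi> x)" using assms(1) by (simp add: periodic1_def)
  ultimately obtain t where "\<And>y. - \<phi> y \<le> - \<phi> t"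
    using periodic1_attains_sup by blast
  then have "p t = 0" "0 \<le> p' t"
    using second_derivative_at_interior_min[OF d1 d2, of "t - 1" t "t + 1"] by auto
  then show ?thesis using riccati[of t] assms(2)[of t] eps
    by (smt (verit) mult_nonneg_nonneg zero_power2 div_0)
qed

text \<open>The extrema of the periodic function \<open>p\<close> are zeros of \<open>p'\<close>,
  and there \<open>p^2 = 2 * (V - E)\<close> with \<open>E \<ge> 0\<close>. The bound is uniform in
  \<epsilon>.\<close>

lemma slope_bounded:
  assumes per: "periodic1 \<phi>" and V: "\<And>x. 0 \<le> V x" "\<And>x. V x \<le> M\<^sup>2 / 2" and M: "0 \<le> M"
  shows "\<bar>p x\<bar> \<le> M"
proof -
  have pper: "p (x + 1) = p x" for x
  proof -
    have "((\<lambda>x. \<phi> (x + 1)) has_real_derivative p (x + 1)) (at x)"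
      using DERIV_shift[of \<phi> "p (x + 1)" x 1] d1 by simp
    moreover have "(\<lambda>x. \<phi> (x + 1)) = \<phi>" using per by (auto simp: periodic1_def)
    ultimately show ?thesis using d1 DERIV_unique by metis
  qed
  have crit: "\<bar>p t\<bar> \<le> M" if "p' t = 0" for t
  proof -
    have "(p t)\<^sup>2 \<le> M\<^sup>2"
      using that riccati[of t] V(2)[of t] energy_nonneg[OF per V(1)] by simp
    then show ?thesis using M by (simp add: power2_le_iff_abs_le)
  qed
  have cont: "continuous_on UNIV p" "continuous_on UNIV (\<lambda>x. - p x)"
    by (intro continuous_at_imp_continuous_on ballI continuous_minus DERIV_isCont[OF d2])+
  obtain s where s: "\<And>y. p y \<le> p s"
    using periodic1_attains_sup[OF _ cont(1)] pper by (auto simp: periodic1_def)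
  obtain t where t: "\<And>y. - p y \<le> - p t"
    using periodic1_attains_sup[OF _ cont(2)] pper by (auto simp: periodic1_def)
  have "p' s = 0" by (rule DERIV_local_max[OF d2, of 1]) (use s in auto)
  moreover have "p' t = 0" by (rule DERIV_local_min[OF d2, of 1]) (use t in auto)
  ultimately show ?thesis using crit[of s] crit[of t] s[of x] t[of x] by linarith
qed

text \<open>Since \<open>V - E = p\<^sup>2 / 2 - \<epsilon> p'\<close>, the quadratic form of \<open>- 2 \<epsilon>\<^sup>2 v'' + (V - E) v\<close> has density
  \<open>(2 \<epsilon> v' + p v)\<^sup>2 / 2 - (\<epsilon> p v\<^sup>2)'\<close>. Evaluated at \<open>v\<^sup>2 = \<gamma>\<close>, this says that \<open>E\<close> is at most the
  energy of the Gaussian; the fourth moment of \<open>\<gamma>\<close> is estimated by \<open>x\<^sup>4 \<ge> 2 \<epsilon> x\<^sup>2 - \<epsilon>\<^sup>2\<close>.\<close>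

lemma energy_upper:
  assumes M: "\<And>x. \<bar>p x\<bar> \<le> M" and D: "0 \<le> D" "D * \<epsilon> \<le> 1" and s: "\<epsilon> \<le> s"
    and well: "\<And>x. \<bar>x\<bar> \<le> s \<Longrightarrow> V (b + x) \<le> x^2 / 2 - D / 2 * x^4 + 2 * D * \<epsilon>^4"
  shows "E \<le> \<epsilon> - D / 2 * \<epsilon>^2 + 2 * D * \<epsilon>^4 + 2 * M * exp (- (s^2 / (2 * \<epsilon>)))"
proof -
  define \<gamma> where "\<gamma> = (\<lambda>x. exp (- (x^2 / (2 * \<epsilon>))))"
  \<comment> \<open>The part \<epsilon> p \<gamma> is the boundary term of the quadratic form. The
    multiples of \<epsilon> x \<gamma>, whose derivative is (\<epsilon> - x^2) \<gamma>, trade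
    second moments of the Gaussian for constants.\<close>
  define G where "G = (\<lambda>x. \<epsilon> * (p (b + x) - x + D * \<epsilon> * x) * \<gamma> x)"
  define \<kappa> where "\<kappa> = E - \<epsilon> + D / 2 * \<epsilon>^2 - 2 * D * \<epsilon>^4"
  define G' where "G' = (\<lambda>x. (((p (b + x))\<^sup>2 / 2 - V (b + x) + E) - \<epsilon> + D * \<epsilon>^2) * \<gamma> x
      - (p (b + x) - x + D * \<epsilon> * x) * x * \<gamma> x)"
  have p_sh: "((\<lambda>x. p (b + x)) has_real_derivative p' (b + x)) (at x)" for x
    using DERIV_shift[of p "p' (b + x)" x b] d2 by (simp add: add.commute)
  have dG: "(G has_real_derivative G' x) (at x)" for x
  proof -
    have "(\<gamma> has_real_derivative - (x / \<epsilon>) * \<gamma> x) (at x)"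
      unfolding \<gamma>_def using eps(1) by (auto intro!: derivative_eq_intros simp: field_simps)
    then have "(G has_real_derivative (\<epsilon> * (p' (b + x) - 1 + D * \<epsilon>)) * \<gamma> x
        + (- (x / \<epsilon>) * \<gamma> x) * (\<epsilon> * (p (b + x) - x + D * \<epsilon> * x))) (at x)"
      unfolding G_def by (auto intro!: derivative_eq_intros p_sh)
    also have "(\<epsilon> * (p' (b + x) - 1 + D * \<epsilon>)) * \<gamma> x
        + (- (x / \<epsilon>) * \<gamma> x) * (\<epsilon> * (p (b + x) - x + D * \<epsilon> * x))
      = (\<epsilon> * p' (b + x) - \<epsilon> + D * \<epsilon>^2) * \<gamma> x
        - (p (b + x) - x + D * \<epsilon> * x) * x * \<gamma> x"
      using eps(1) by (simp add: field_simps power2_eq_square)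
    finally show ?thesis unfolding riccati G'_def .
  qed
  have lower: "\<kappa> * \<gamma> x \<le> G' x" if "\<bar>x\<bar> \<le> s" for x
  proof -
    \<comment> \<open>After completing squares, \<open>G' - \<kappa> * \<gamma>\<close> is bounded
      below by \<gamma> times the sum of this square and \<open>(p - x)^2 / 2\<close>.\<close>
    have "0 \<le> D / 2 * (x^2 - \<epsilon>)^2" using D by simp
    then have "\<kappa> \<le> ((p (b + x))\<^sup>2 / 2 - V (b + x) + E) - \<epsilon> + D * \<epsilon>^2
        - (p (b + x) - x + D * \<epsilon> * x) * x"
      using well[OF that] zero_le_power2[of "p (b + x) - x"] unfolding \<kappa>_def
      by (simp add: power2_eq_square power4_eq_xxxx algebra_simps)
    then have "\<kappa> * \<gamma> x \<le> (((p (b + x))\<^sup>2 / 2 - V (b + x) + E) - \<epsilon> + D * \<epsilon>^2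
        - (p (b + x) - x + D * \<epsilon> * x) * x) * \<gamma> x"
      by (intro mult_right_mono) (auto simp: \<gamma>_def)
    then show ?thesis by (simp add: G'_def algebra_simps)
  qed
  have "\<kappa> \<le> 2 * M * \<gamma> s"
  proof (cases "\<kappa> \<le> 0")
    case True
    moreover have "0 \<le> M" using M[of 0] by linarith
    ultimately show ?thesis by (smt (verit) \<gamma>_def exp_ge_zero mult_nonneg_nonneg)
  next
    case False
    \<comment> \<open>For positive \<kappa>, \<open>G\<close> increases on \<open>[-s, s]\<close>
      and gains at least \<kappa> \<epsilon> on \<open>[-\<epsilon>, \<epsilon>]\<close> alone. The
      boundary values at -s and s allow a gain of at most 2 M \<epsilon> \<gamma>(s).\<close>
    then have mono: "G x \<le> G y" if "- s \<le> x" "x \<le> y" "y \<le> s" for x y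
      using deriv_ge_increment[OF that(2) dG, of 0] lower that
      by (smt (verit, best) \<gamma>_def exp_ge_zero mult_nonneg_nonneg mult_zero_left)
    have half: "\<kappa> / 2 \<le> G' x" if "\<bar>x\<bar> \<le> \<epsilon>" for x
    proof -
      have "x^2 \<le> \<epsilon> * \<epsilon>" using that eps abs_le_square_iff[of x \<epsilon>] by (simp add: power2_eq_square)
      then have "x^2 / (2 * \<epsilon>) \<le> 1 / 2" using eps
        by (simp add: divide_le_eq) (smt (verit) mult_left_le)
      then have "1 / 2 \<le> \<gamma> x" using exp_ge_add_one_self[of "- (x^2 / (2 * \<epsilon>))"]
        by (simp add: \<gamma>_def)
      then have "\<kappa> * (1 / 2) \<le> \<kappa> * \<gamma> x" using False by (intro mult_left_mono) auto
      then show ?thesis using lower[of x] that s by simp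
    qed
    have "\<kappa> / 2 * (\<epsilon> - - \<epsilon>) \<le> G \<epsilon> - G (- \<epsilon>)"
      by (rule deriv_ge_increment[OF _ dG]) (use eps half in auto)
    also have "\<dots> \<le> G s - G (- s)" using mono[of "- s" "- \<epsilon>"] mono[of \<epsilon> s] s eps by simp
    also have "\<dots> = \<epsilon> * \<gamma> s * (p (b + s) - p (b - s) - 2 * (s * (1 - D * \<epsilon>)))"
      by (simp add: G_def \<gamma>_def algebra_simps)
    also have "\<dots> \<le> \<epsilon> * \<gamma> s * (2 * M)"
    proof (rule mult_left_mono)
      have "0 \<le> s * (1 - D * \<epsilon>)" using s eps D by simp
      then show "p (b + s) - p (b - s) - 2 * (s * (1 - D * \<epsilon>)) \<le> 2 * M"
        using M[of "b + s"] M[of "b - s"] by linarith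
    qed (use eps in \<open>simp add: \<gamma>_def\<close>)
    finally have "\<epsilon> * \<kappa> \<le> \<epsilon> * (2 * M * \<gamma> s)" by (simp add: mult_ac)
    then show ?thesis using eps by simp
  qed
  then show ?thesis by (simp add: \<kappa>_def \<gamma>_def)
qed

text \<open>\<open>W\<close> is, up to a constant factor, the product of the ground state \<open>exp (- \<phi> / (2 \<epsilon>))\<close> and
  the Gaussian \<open>exp (- x\<^sup>2 / (4 \<epsilon>))\<close>, and \<open>G\<close> is a multiple of their Wronskian.\<close>

lemma well_energy_estimate:
  assumes M: "\<And>x. \<bar>p x\<bar> \<le> M" and D: "0 \<le> D" and s: "\<epsilon> \<le> s" "s \<le> r" "r \<le> 1"
    and small: "\<epsilon>^2 \<le> 1 / 8" and E: "E \<le> \<epsilon> - D / 4 * \<epsilon>^2"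
    and near: "\<And>x. \<bar>x\<bar> \<le> s \<Longrightarrow> x^2 / 2 - D * \<epsilon>^4 \<le> V (b + x)"
    and far: "\<And>x. \<bar>x\<bar> \<le> r \<Longrightarrow> x^2 / 2 - D \<le> V (b + x)"
    and flat: "\<And>x. \<bar>x\<bar> \<le> r \<Longrightarrow> \<phi> b - 2 * M * sqrt \<epsilon> \<le> \<phi> (b + x)"
    and walls: "\<phi> b + \<delta> \<le> \<phi> (b + r)" "\<phi> b + \<delta> \<le> \<phi> (b - r)"
  shows "D / 4 * \<epsilon>^3 * exp (- (M / 2) - 1)
    \<le> 2 * \<epsilon> * (M + 1) * exp (- (\<delta> / (2 * \<epsilon>))) + 2 * D * exp (M / sqrt \<epsilon> - s^2 / (4 * \<epsilon>))"
proof -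
  define W where "W = (\<lambda>x. exp (- ((\<phi> (b + x) - \<phi> b) / (2 * \<epsilon>) + x^2 / (4 * \<epsilon>))))"
  define G where "G = (\<lambda>x. \<epsilon> * (p (b + x) - x) * W x)"
  define G' where "G' = (\<lambda>x. (E - \<epsilon> - (V (b + x) - x^2 / 2)) * W x)"
  have Wpos: "0 < W x" for x by (simp add: W_def)
  have M0: "0 \<le> M" using M[of 0] by linarith
  have p_sh: "((\<lambda>x. p (b + x)) has_real_derivative p' (b + x)) (at x)" for x
    using DERIV_shift[of p "p' (b + x)" x b] d2 by (simp add: add.commute)
  have phi_sh: "((\<lambda>x. \<phi> (b + x)) has_real_derivative p (b + x)) (at x)" for x
    using DERIV_shift[of \<phi> "p (b + x)" x b] d1 by (simp add: add.commute)
  have dG: "(G has_real_derivative G' x) (at x)" for x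
  proof -
    have dW: "(W has_real_derivative W x * (- (p (b + x) / (2 * \<epsilon>) + 2 * x / (4 * \<epsilon>)))) (at x)"
      unfolding W_def using eps(1)
      by (auto intro!: derivative_eq_intros phi_sh; simp add: field_simps)
    have "(G has_real_derivative (\<epsilon> * (p' (b + x) - 1)) * W x
        + (\<epsilon> * (p (b + x) - x)) * (W x * (- (p (b + x) / (2 * \<epsilon>) + 2 * x / (4 * \<epsilon>))))) (at x)"
      unfolding G_def by (auto intro!: derivative_eq_intros p_sh dW)
    \<comment> \<open>The squares of \<open>p\<close> cancel between this expression and the Riccati
      equation; only the differences of the energies and of the potentials remain.\<close>
    moreover have "(\<epsilon> * (p' (b + x) - 1)) * W x
        + (\<epsilon> * (p (b + x) - x)) * (W x * (- (p (b + x) / (2 * \<epsilon>) + 2 * x / (4 * \<epsilon>))))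
      = (\<epsilon> * p' (b + x) - \<epsilon> - (p (b + x) - x) * (p (b + x) + x) / 2) * W x"
      using eps(1) by (simp add: field_simps)
    moreover have "\<dots> = G' x"
      unfolding riccati G'_def by (simp add: field_simps power2_eq_square)
    ultimately show ?thesis by simp
  qed
  \<comment> \<open>The energy deficit \<open>D / 4 * \<epsilon>^2\<close> is twice the largest
    possible effect of the error \<open>D * \<epsilon>^4\<close> in the potential.\<close>
  have inner: "G' x \<le> - (D / 8 * \<epsilon>^2) * W x" if "\<bar>x\<bar> \<le> s" for x
  proof -
    have "D * \<epsilon>^2 * \<epsilon>^2 \<le> D * \<epsilon>^2 * (1 / 8)" using D small by (intro mult_left_mono) auto
    then have "D * \<epsilon>^4 \<le> D / 8 * \<epsilon>^2" by (simp add: power4_eq_xxxx power2_eq_square mult_ac)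
    then have "E - \<epsilon> - (V (b + x) - x^2 / 2) \<le> - (D / 8 * \<epsilon>^2)"
      using E near[OF that] by simp
    then show ?thesis unfolding G'_def using Wpos by (intro mult_right_mono) (auto intro: less_imp_le)
  qed
  define \<tau> where "\<tau> = exp (M / sqrt \<epsilon> - s^2 / (4 * \<epsilon>))"
  \<comment> \<open>Away from the core the sign of \<open>G'\<close> is not controlled, but
    \<open>flat\<close> limits the growth of the ground state and the Gaussian factor makes
    \<open>W\<close> tiny.\<close>
  have outer: "G' x \<le> D * \<tau>" if "s \<le> \<bar>x\<bar>" "\<bar>x\<bar> \<le> r" for x
  proof -
    have "0 \<le> D / 4 * \<epsilon>^2" using D by simp
    then have "E - \<epsilon> - (V (b + x) - x^2 / 2) \<le> D" using E far[OF that(2)] by linarith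
    then have "G' x \<le> D * W x" unfolding G'_def using Wpos by (intro mult_right_mono) (auto intro: less_imp_le)
    also have "\<dots> \<le> D * \<tau>"
    proof (rule mult_left_mono[OF _ D])
      have "- (2 * M * sqrt \<epsilon> / (2 * \<epsilon>)) \<le> (\<phi> (b + x) - \<phi> b) / (2 * \<epsilon>)"
        using flat[OF that(2)] eps(1) by (simp add: divide_simps)
      moreover have "2 * M * sqrt \<epsilon> / (2 * \<epsilon>) = M / sqrt \<epsilon>"
        using eps(1) by (simp add: field_simps)
      moreover have "s^2 / (4 * \<epsilon>) \<le> x^2 / (4 * \<epsilon>)"
        using that(1) s(1) eps abs_le_square_iff[of s x] by (intro divide_right_mono) auto
      ultimately show "W x \<le> \<tau>" unfolding W_def \<tau>_def by simp
    qed
    finally show ?thesis .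
  qed
  \<comment> \<open>On \<open>[-\<epsilon>, \<epsilon>]\<close> the slope bound keeps
    \<open>W\<close> above a constant independent of \<epsilon>.\<close>
  have core: "G' x \<le> - (D / 8 * \<epsilon>^2 * exp (- (M / 2) - 1))" if "\<bar>x\<bar> \<le> \<epsilon>" for x
  proof -
    have "\<bar>\<phi> (b + x) - \<phi> b\<bar> \<le> M * \<bar>(b + x) - b\<bar>"
      using field_differentiable_bound[OF convex_UNIV, of \<phi> p M b "b + x"] d1 M by auto
    also have "\<dots> \<le> M * \<epsilon>" using that M0 by (intro mult_left_mono) auto
    finally have "(\<phi> (b + x) - \<phi> b) / (2 * \<epsilon>) \<le> M * \<epsilon> / (2 * \<epsilon>)"
      using eps(1) by (intro divide_right_mono) auto
    also have "\<dots> = M / 2" using eps(1) by simp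
    finally have "(\<phi> (b + x) - \<phi> b) / (2 * \<epsilon>) \<le> M / 2" .
    moreover have "x^2 / (4 * \<epsilon>) \<le> 1"
    proof -
      have "x^2 \<le> \<epsilon> * \<epsilon>" using that eps abs_le_square_iff[of x \<epsilon>] by (simp add: power2_eq_square)
      also have "\<dots> \<le> \<epsilon> * 1" using eps by (intro mult_left_mono) auto
      finally show ?thesis using eps by (simp add: divide_le_eq)
    qed
    ultimately have "exp (- (M / 2) - 1) \<le> W x"
      unfolding W_def by (subst exp_le_cancel_iff) linarith
    then have "D / 8 * \<epsilon>^2 * exp (- (M / 2) - 1) \<le> D / 8 * \<epsilon>^2 * W x"
      using D by (intro mult_left_mono) auto
    then show ?thesis using inner[of x] that s by simp
  qed
  have neg: "G' x \<le> 0" if "\<bar>x\<bar> \<le> s" for x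
  proof -
    have "0 \<le> D / 8 * \<epsilon>^2 * W x" using D Wpos[of x] by simp
    then show ?thesis using inner[OF that] by simp
  qed
  \<comment> \<open>The interval is cut at -s, -\<epsilon>, \<epsilon> and s: a definite decrease of
    order \<epsilon>^3 in the core, no increase up to s, and at most \<open>D * \<tau>\<close> on
    each outer piece.\<close>
  have steps: "G \<epsilon> - G (- \<epsilon>) \<le> - (D / 8 * \<epsilon>^2 * exp (- (M / 2) - 1)) * (\<epsilon> - - \<epsilon>)"
    "G s - G \<epsilon> \<le> 0 * (s - \<epsilon>)" "G (- \<epsilon>) - G (- s) \<le> 0 * (- \<epsilon> - - s)"
    "G r - G s \<le> D * \<tau> * (r - s)" "G (- s) - G (- r) \<le> D * \<tau> * (- s - - r)"
    by (rule deriv_le_increment[OF _ dG]; use eps s core neg outer in auto)+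
  have "D * \<tau> * (r - s) \<le> D * \<tau> * 1" using D s eps by (intro mult_left_mono) (auto simp: \<tau>_def)
  then have diff: "G r - G (- r) \<le> 2 * (D * \<tau>) - (D / 4 * \<epsilon>^3 * exp (- (M / 2) - 1))"
    using steps by (simp add: power3_eq_cube power2_eq_square algebra_simps)
  \<comment> \<open>The walls make the ground state exponentially small at -r and r, so
    \<open>G\<close> cannot have decreased by much overall.\<close>
  have bdry: "\<bar>G x\<bar> \<le> \<epsilon> * (M + 1) * exp (- (\<delta> / (2 * \<epsilon>)))"
    if "\<bar>x\<bar> = r" "\<phi> b + \<delta> \<le> \<phi> (b + x)" for x
  proof -
    have "\<delta> / (2 * \<epsilon>) \<le> (\<phi> (b + x) - \<phi> b) / (2 * \<epsilon>)"
      using that eps(1) by (intro divide_right_mono) auto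
    moreover have "0 \<le> x^2 / (4 * \<epsilon>)" using eps by simp
    ultimately have "W x \<le> exp (- (\<delta> / (2 * \<epsilon>)))" unfolding W_def by simp
    moreover have "\<bar>p (b + x) - x\<bar> \<le> M + 1" using M[of "b + x"] that s by linarith
    ultimately have "\<bar>p (b + x) - x\<bar> * W x \<le> (M + 1) * exp (- (\<delta> / (2 * \<epsilon>)))"
      using M0 Wpos[of x] by (intro mult_mono) auto
    then have "\<epsilon> * (\<bar>p (b + x) - x\<bar> * W x) \<le> \<epsilon> * ((M + 1) * exp (- (\<delta> / (2 * \<epsilon>))))"
      using eps by (intro mult_left_mono) auto
    then show ?thesis using eps Wpos[of x] by (simp add: G_def abs_mult mult_ac)
  qed
  show ?thesis using diff bdry[of r] bdry[of "- r"] walls s eps by (simp add: \<tau>_def)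
qed

end

section \<open>Resonant viscosities and the vanishing viscosity limit\<close>

lemma resonant_omega_bounds:
  assumes eps: "0 < \<epsilon>" "\<epsilon> < 1" and res: "sin (ln (ln (1 / \<epsilon>) / 2)) = \<sigma>" and \<sigma>: "\<sigma>\<^sup>2 = 1"
    and x: "\<bar>x\<bar> \<le> \<epsilon> powr (1/5)"
  shows "x^4 / 2 - 2 * \<epsilon>^4 \<le> x^4 * (\<sigma> * omega \<bar>x\<bar>)" "- (\<epsilon>^4) \<le> x^4 * (\<sigma> * omega \<bar>x\<bar>)"
proof -
  have "x^4 / 2 - 2 * \<epsilon>^4 \<le> x^4 * (\<sigma> * omega \<bar>x\<bar>) \<and> - (\<epsilon>^4) \<le> x^4 * (\<sigma> * omega \<bar>x\<bar>)"
  proof (cases "\<epsilon> \<le> \<bar>x\<bar>")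
    case True
    then have "x^4 * (1 / 2) \<le> x^4 * (\<sigma> * omega \<bar>x\<bar>)"
      using omega_resonant[OF eps res \<sigma> True x] by (intro mult_left_mono) auto
    moreover have "0 \<le> x^4" "0 \<le> \<epsilon>^4" by auto
    ultimately show ?thesis by linarith
  next
    case False
    \<comment> \<open>Below scale \<epsilon> the sign of \<open>omega\<close> is unknown, but the
      whole term is at most \<epsilon>^4 there, negligible against the energy gap of order
      \<epsilon>^2.\<close>
    then have "\<bar>x\<bar>^4 \<le> \<epsilon>^4" by (intro power_mono) auto
    then have le: "x^4 \<le> \<epsilon>^4" by simp
    have "\<bar>\<sigma>\<bar> = 1" using \<sigma> by (auto simp: power2_eq_1_iff)
    then have "\<bar>\<sigma> * omega \<bar>x\<bar>\<bar> \<le> 1" using omega_bounded[of "\<bar>x\<bar>"] by (simp add: abs_mult)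
    then have "x^4 * (- 1) \<le> x^4 * (\<sigma> * omega \<bar>x\<bar>)" by (intro mult_left_mono) auto
    moreover have "0 \<le> \<epsilon>^4" by simp
    ultimately show ?thesis using le by linarith
  qed
  then show "x^4 / 2 - 2 * \<epsilon>^4 \<le> x^4 * (\<sigma> * omega \<bar>x\<bar>)" "- (\<epsilon>^4) \<le> x^4 * (\<sigma> * omega \<bar>x\<bar>)"
    by auto
qed

locale vanishing_viscosity =
  fixes V g E :: "real \<Rightarrow> real" and \<phi> p p' :: "real \<Rightarrow> real \<Rightarrow> real" and M :: real
  assumes sol: "\<And>\<epsilon>. 0 < \<epsilon> \<Longrightarrow> \<epsilon> < 1 \<Longrightarrow> viscous_hj V (\<phi> \<epsilon>) (p \<epsilon>) (p' \<epsilon>) \<epsilon> (E \<epsilon>)"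
    and slope: "\<And>\<epsilon> x. 0 < \<epsilon> \<Longrightarrow> \<epsilon> < 1 \<Longrightarrow> \<bar>p \<epsilon> x\<bar> \<le> M" and M: "0 < M"
    and lim: "uniform_limit UNIV \<phi> g (at_right 0)"
begin

lemma eventually_in_unit: "\<forall>\<^sub>F \<epsilon> in at_right 0. 0 < \<epsilon> \<and> \<epsilon> < (1 :: real)"
  by (auto simp: eventually_at_right_field intro!: exI[of _ 1])

lemma eventually_close: "0 < \<delta> \<Longrightarrow> \<forall>\<^sub>F \<epsilon> in at_right 0. \<forall>x. \<bar>\<phi> \<epsilon> x - g x\<bar> < \<delta>"
  using uniform_limitD[OF lim, of \<delta>] by (simp add: dist_real_def)

lemma limit_continuous: "continuous_on UNIV g"
proof (rule uniform_limit_theorem[OF _ lim])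
  show "\<forall>\<^sub>F \<epsilon> in at_right 0. continuous_on UNIV (\<phi> \<epsilon>)"
    using eventually_in_unit
  proof eventually_elim
    case (elim \<epsilon>)
    then interpret viscous_hj V "\<phi> \<epsilon>" "p \<epsilon>" "p' \<epsilon>" \<epsilon> "E \<epsilon>" using sol by blast
    show ?case by (intro continuous_at_imp_continuous_on ballI DERIV_isCont[OF d1])
  qed
qed simp

lemma limit_periodic:
  assumes "\<And>\<epsilon>. 0 < \<epsilon> \<Longrightarrow> \<epsilon> < 1 \<Longrightarrow> periodic1 (\<phi> \<epsilon>)"
  shows "periodic1 g"
  unfolding periodic1_def
proof
  fix x
  have l: "((\<lambda>\<epsilon>. \<phi> \<epsilon> y) \<longlongrightarrow> g y) (at_right 0)" for y
    using tendsto_uniform_limitI[OF lim] by simp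
  have "\<forall>\<^sub>F \<epsilon> in at_right 0. \<phi> \<epsilon> (x + 1) = \<phi> \<epsilon> x"
    using eventually_in_unit by eventually_elim (use assms in \<open>auto simp: periodic1_def\<close>)
  then have "((\<lambda>\<epsilon>. \<phi> \<epsilon> x) \<longlongrightarrow> g (x + 1)) (at_right 0)"
    by (rule Lim_transform_eventually[OF l])
  then show "g (x + 1) = g x" using tendsto_unique[OF _ _ l[of x]] by simp
qed

text \<open>The sign \<open>- sgn B\<close> makes the quartic term lower the potential at
  \<open>b\<close> on all scales from \<epsilon> to \<open>\<epsilon> powr (1/5)\<close>. Then
  \<open>energy_upper\<close> gains \<open>\<bar>B\<bar> / 2 * \<epsilon>^2\<close>, half of which
  pays for the errors.\<close>

lemma resonance:
  assumes B: "B \<noteq> 0" and \<rho>: "0 < \<rho>"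
    and wb: "\<And>x. \<bar>x\<bar> < \<rho> \<Longrightarrow> V (b + x) = x^2 / 2 + B * x^4 * omega \<bar>x\<bar>"
  shows "\<exists>\<^sub>F \<epsilon> in at_right 0. sin (ln (ln (1 / \<epsilon>) / 2)) = - sgn B \<and> E \<epsilon> \<le> \<epsilon> - \<bar>B\<bar> / 4 * \<epsilon>^2"
proof -
  define D where "D = \<bar>B\<bar>"
  define \<sigma> where "\<sigma> = - sgn B"
  have D: "0 < D" using B by (simp add: D_def)
  have \<sigma>: "\<sigma>\<^sup>2 = 1" "\<sigma> = 1 \<or> \<sigma> = - 1" using B by (auto simp: \<sigma>_def sgn_if)
  have "\<forall>\<^sub>F \<epsilon> in at_right 0. D * \<epsilon> \<le> 1 \<and> \<epsilon> \<le> \<epsilon> powr (1/5) \<and> \<epsilon> powr (1/5) < \<rho>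
      \<and> 2 * D * \<epsilon>^4 + 2 * M * exp (- ((\<epsilon> powr (1/5))^2 / (2 * \<epsilon>))) \<le> D / 4 * \<epsilon>^2"
    using D M \<rho> by (intro eventually_conj; real_asymp)
  then have ev: "\<forall>\<^sub>F \<epsilon> in at_right 0. sin (ln (ln (1 / \<epsilon>) / 2)) = \<sigma> \<longrightarrow> E \<epsilon> \<le> \<epsilon> - D / 4 * \<epsilon>^2"
    using eventually_in_unit
  proof eventually_elim
    case (elim \<epsilon>)
    define s where "s = \<epsilon> powr (1/5)"
    have e: "0 < \<epsilon>" "\<epsilon> < 1" using elim by auto
    interpret viscous_hj V "\<phi> \<epsilon>" "p \<epsilon>" "p' \<epsilon>" \<epsilon> "E \<epsilon>" using sol e by blast
    have "E \<epsilon> \<le> \<epsilon> - D / 2 * \<epsilon>^2 + 2 * D * \<epsilon>^4 + 2 * M * exp (- (s^2 / (2 * \<epsilon>)))"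
      if res: "sin (ln (ln (1 / \<epsilon>) / 2)) = \<sigma>"
    proof (rule energy_upper)
      show "V (b + x) \<le> x^2 / 2 - D / 2 * x^4 + 2 * D * \<epsilon>^4" if "\<bar>x\<bar> \<le> s" for x
      proof -
        have "D * (x^4 / 2 - 2 * \<epsilon>^4) \<le> D * (x^4 * (\<sigma> * omega \<bar>x\<bar>))"
          using resonant_omega_bounds(1)[OF e res \<sigma>(1), of x] that D
          by (intro mult_left_mono) (auto simp: s_def)
        moreover have "B = - D * \<sigma>" by (simp add: D_def \<sigma>_def sgn_if)
        ultimately show ?thesis using wb[of x] that elim by (simp add: s_def algebra_simps)
      qed
    qed (use slope e elim D in \<open>auto simp: s_def\<close>)
    then show ?case using elim(1) unfolding s_def by linarith
  qed
  show ?thesis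
    using frequently_eventually_frequently[OF frequently_resonant[OF \<sigma>(2)] ev]
    by (rule frequently_elim1) (simp add: D_def \<sigma>_def)
qed

text \<open>Along viscosities resonant for \<open>b\<close>, the energy lies below \<epsilon> by
  order \<epsilon>^2 although the well at \<open>c\<close> is essentially no lower than x^2 / 2.
  Walls on both sides of \<open>c\<close> would contradict
  \<open>well_energy_estimate\<close>.\<close>

lemma no_local_min_at_other_well:
  assumes B: "B \<noteq> 0" and \<rho>: "0 < \<rho>" "\<rho> < 1" "2 * \<bar>B\<bar> * \<rho>^2 \<le> 1 / 4"
    and wb: "\<And>x. \<bar>x\<bar> < \<rho> \<Longrightarrow> V (b + x) = x^2 / 2 + B * x^4 * omega \<bar>x\<bar>"
    and wc: "\<And>x. \<bar>x\<bar> < \<rho> \<Longrightarrow> V (c + x) = x^2 / 2 - B * x^4 * omega \<bar>x\<bar>"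
    and r: "0 < r" "r < \<rho>"
  shows "g (c + r) \<le> g c \<or> g (c - r) \<le> g c"
proof (rule ccontr)
  assume neg: "\<not> ?thesis"
  \<comment> \<open>Two uniform errors below \<delta> leave at least \<delta> of the gap 3
    \<delta>.\<close>
  define \<delta> where "\<delta> = min (g (c + r) - g c) (g (c - r) - g c) / 3"
  define D where "D = \<bar>B\<bar>"
  define \<sigma> where "\<sigma> = - sgn B"
  have D: "0 < D" using B by (simp add: D_def)
  have \<sigma>: "\<sigma>\<^sup>2 = 1" using B by (auto simp: \<sigma>_def sgn_if)
  have BD: "B = - D * \<sigma>" by (simp add: D_def \<sigma>_def sgn_if)
  have \<delta>: "0 < \<delta>" using neg by (simp add: \<delta>_def)
  \<comment> \<open>With s = \<epsilon>^(1/5), s^2 / \<epsilon> = \<epsilon>^(-3/5) outgrows M /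
    sqrt \<epsilon>, so both exponential terms are beaten by \<epsilon>^3.\<close>
  have ev: "\<forall>\<^sub>F \<epsilon> in at_right 0. \<epsilon> \<le> \<epsilon> powr (1/5) \<and> \<epsilon> powr (1/5) \<le> r \<and> \<epsilon>^2 \<le> 1 / 8
      \<and> 2 * sqrt \<epsilon> \<le> r
      \<and> D / 4 * \<epsilon>^3 * exp (- (M / 2) - 1)
        > 2 * \<epsilon> * (M + 1) * exp (- (\<delta> / (2 * \<epsilon>)))
          + 2 * D * exp (M / sqrt \<epsilon> - (\<epsilon> powr (1/5))^2 / (4 * \<epsilon>))"
    using D M \<delta> r by (intro eventually_conj; real_asymp)
  obtain \<epsilon> where res: "sin (ln (ln (1 / \<epsilon>) / 2)) = \<sigma>" and E: "E \<epsilon> \<le> \<epsilon> - D / 4 * \<epsilon>^2"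
    and e: "0 < \<epsilon>" "\<epsilon> < 1" and s: "\<epsilon> \<le> \<epsilon> powr (1/5)" "\<epsilon> powr (1/5) \<le> r"
    and small: "\<epsilon>^2 \<le> 1 / 8" "2 * sqrt \<epsilon> \<le> r"
    and gt: "D / 4 * \<epsilon>^3 * exp (- (M / 2) - 1)
        > 2 * \<epsilon> * (M + 1) * exp (- (\<delta> / (2 * \<epsilon>)))
          + 2 * D * exp (M / sqrt \<epsilon> - (\<epsilon> powr (1/5))^2 / (4 * \<epsilon>))"
    and close: "\<And>x. \<bar>\<phi> \<epsilon> x - g x\<bar> < \<delta>"
    using frequently_ex[OF frequently_eventually_frequently[OF resonance[OF B \<rho>(1) wb]
      eventually_conj[OF eventually_in_unit eventually_conj[OF ev eventually_close[OF \<delta>]]]]]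
    unfolding D_def \<sigma>_def by blast
  interpret viscous_hj V "\<phi> \<epsilon>" "p \<epsilon>" "p' \<epsilon>" \<epsilon> "E \<epsilon>" using sol e by blast
  define s where "s = \<epsilon> powr (1/5)"
  have walls: "\<phi> \<epsilon> c + \<delta> \<le> \<phi> \<epsilon> (c + r)" "\<phi> \<epsilon> c + \<delta> \<le> \<phi> \<epsilon> (c - r)"
  proof -
    have "3 * \<delta> \<le> g (c + r) - g c" "3 * \<delta> \<le> g (c - r) - g c" by (auto simp: \<delta>_def)
    then show "\<phi> \<epsilon> c + \<delta> \<le> \<phi> \<epsilon> (c + r)" "\<phi> \<epsilon> c + \<delta> \<le> \<phi> \<epsilon> (c - r)"
      using close[of c] close[of "c + r"] close[of "c - r"] by linarith+
  qed
  have bound: "\<bar>B * x^4 * omega \<bar>x\<bar>\<bar> \<le> D * x^4" for x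
  proof -
    have "D * x^4 * \<bar>omega \<bar>x\<bar>\<bar> \<le> D * x^4 * 1"
      using D omega_bounded by (intro mult_left_mono) auto
    then show ?thesis by (simp add: abs_mult D_def)
  qed
  have near: "x^2 / 2 - D * \<epsilon>^4 \<le> V (c + x)" if "\<bar>x\<bar> \<le> s" for x
  proof -
    have "D * (- (\<epsilon>^4)) \<le> D * (x^4 * (\<sigma> * omega \<bar>x\<bar>))"
      using resonant_omega_bounds(2)[OF e res \<sigma>, of x] that D
      by (intro mult_left_mono) (auto simp: s_def)
    then show ?thesis using wc[of x] that s r by (simp add: BD s_def algebra_simps)
  qed
  have far: "x^2 / 2 - D \<le> V (c + x)" if "\<bar>x\<bar> \<le> r" for x
  proof -
    have "\<bar>x\<bar>^4 \<le> 1" using that r \<rho> by (intro power_le_one) auto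
    then have "D * x^4 \<le> D * 1" using D by (intro mult_left_mono) auto
    then show ?thesis using wc[of x] bound[of x] that r by simp
  qed
  \<comment> \<open>The smallness of \<rho> bounds the quartic term by x^2 / 8, so here V \<ge> 3/8
    x^2 \<ge> 3/2 \<epsilon>.\<close>
  have above: "\<epsilon> < V (c + x)" if "2 * sqrt \<epsilon> \<le> \<bar>x\<bar>" "\<bar>x\<bar> \<le> r" for x
  proof -
    have "x^2 \<le> \<rho>^2" using that r by (intro abs_le_square_iff[THEN iffD1]) auto
    then have "2 * D * x^2 \<le> 2 * D * \<rho>^2" using D by (intro mult_left_mono) auto
    then have "2 * D * x^2 \<le> 1 / 4" using \<rho>(3) D_def by simp
    then have "(2 * D * x^2) * x^2 \<le> 1 / 4 * x^2" by (intro mult_right_mono) auto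
    then have "D * x^4 \<le> x^2 / 8" by (simp add: power4_eq_xxxx power2_eq_square mult_ac)
    moreover have "(2 * sqrt \<epsilon>)^2 \<le> x^2"
      using that e by (intro abs_le_square_iff[THEN iffD1]) auto
    then have "4 * \<epsilon> \<le> x^2" using e by (simp add: power_mult_distrib)
    ultimately show ?thesis using wc[of x] bound[of x] that r e by simp
  qed
  have lip: "\<phi> \<epsilon> c - 2 * M * sqrt \<epsilon> \<le> \<phi> \<epsilon> (c + x)" if "\<bar>x\<bar> \<le> 2 * sqrt \<epsilon>" for x
  proof -
    have "\<bar>\<phi> \<epsilon> (c + x) - \<phi> \<epsilon> c\<bar> \<le> M * \<bar>(c + x) - c\<bar>"
      using field_differentiable_bound[OF convex_UNIV, of "\<phi> \<epsilon>" "p \<epsilon>" M c "c + x"] d1 slope[OF e]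
      by auto
    also have "\<dots> \<le> M * (2 * sqrt \<epsilon>)" using that M by (intro mult_left_mono) auto
    finally show ?thesis by simp
  qed
  have E_le: "E \<epsilon> \<le> \<epsilon>"
    using E D e by (smt (verit) zero_le_power2 mult_nonneg_nonneg divide_nonneg_nonneg)
  \<comment> \<open>By \<open>lip\<close> a violation lies beyond distance 2 sqrt \<epsilon> from
    \<open>c\<close>, and is lower than both ends of the interval from there to the wall. This
    yields an interior minimum with V \<le> E \<le> \<epsilon>, excluded by
    \<open>above\<close>.\<close>
  have flat: "\<phi> \<epsilon> c - 2 * M * sqrt \<epsilon> \<le> \<phi> \<epsilon> (c + x)" if x: "\<bar>x\<bar> \<le> r" for x
  proof (rule ccontr)
    assume "\<not> ?thesis"
    then have lt: "\<phi> \<epsilon> (c + x) < \<phi> \<epsilon> c - 2 * M * sqrt \<epsilon>" by simp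
    have "2 * sqrt \<epsilon> < \<bar>x\<bar>" using lip[of x] lt by linarith
    have "\<phi> \<epsilon> (c + x) < \<phi> \<epsilon> (c + 2 * sqrt \<epsilon>)" "\<phi> \<epsilon> (c + x) < \<phi> \<epsilon> (c - 2 * sqrt \<epsilon>)"
      using lip[of "2 * sqrt \<epsilon>"] lip[of "- (2 * sqrt \<epsilon>)"] lt e by auto
    moreover have "0 \<le> 2 * M * sqrt \<epsilon>" using M e by simp
    then have "\<phi> \<epsilon> (c + x) < \<phi> \<epsilon> (c + r)" "\<phi> \<epsilon> (c + x) < \<phi> \<epsilon> (c - r)"
      using lt walls \<delta> by linarith+
    moreover from this have "x \<noteq> r" "x \<noteq> - r" by auto
    then have "x < r" "- r < x" using x by linarith+
    moreover have "c + 2 * sqrt \<epsilon> < c + x \<or> c + x < c - 2 * sqrt \<epsilon>"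
      using \<open>2 * sqrt \<epsilon> < \<bar>x\<bar>\<close> by linarith
    ultimately obtain t where "V t \<le> E \<epsilon>"
      "c + 2 * sqrt \<epsilon> < t \<and> t < c + r \<or> c - r < t \<and> t < c - 2 * sqrt \<epsilon>"
      using interior_min[of "c + 2 * sqrt \<epsilon>" "c + x" "c + r" 0]
        interior_min[of "c - r" "c + x" "c - 2 * sqrt \<epsilon>" 0] x by auto
    moreover from this(2) have "2 * sqrt \<epsilon> \<le> \<bar>t - c\<bar>" "\<bar>t - c\<bar> \<le> r"
      using e real_sqrt_ge_zero[of \<epsilon>] by linarith+
    ultimately show False using above[of "t - c"] E_le by simp
  qed
  show False
    using well_energy_estimate[where M = M and D = D and s = s and r = r and b = c and \<delta> = \<delta>]
      slope[OF e] D s r \<rho> small E near far flat walls gt by (simp add: s_def)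
qed

text \<open>A weak inequality for \<open>g\<close> becomes a strict one for the approximations once
  a small parabola is added, and \<open>interior_min\<close> then produces a point where V is below
  its positive minimum.\<close>

lemma limit_no_interior_min:
  assumes V: "continuous_on UNIV V" "\<And>t. x \<le> t \<Longrightarrow> t \<le> z \<Longrightarrow> 0 < V t"
    and freq: "\<exists>\<^sub>F \<epsilon> in at_right 0. E \<epsilon> \<le> \<epsilon>"
    and xyz: "x < y" "y < z" and le: "g y \<le> g x" "g y \<le> g z"
  shows False
proof -
  obtain t0 where t0: "t0 \<in> {x..z}" "\<And>t. t \<in> {x..z} \<Longrightarrow> V t0 \<le> V t"
    using continuous_attains_inf[of "{x..z}" V] xyz continuous_on_subset[OF V(1)] by auto
  define m where "m = V t0"
  have m: "0 < m" using V(2) t0 by (auto simp: m_def)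
  \<comment> \<open>This bounds the parabola term 2 \<eta>^2 (t - y)^2 by m / 3, the cap 1 giving
    \<eta>^2 \<le> \<eta>; the terms with \<epsilon> cost less than another m / 3.\<close>
  define \<eta> where "\<eta> = min 1 (m / (6 * (z - x)^2))"
  have zx: "0 < (z - x)^2" using xyz by simp
  have \<eta>: "0 < \<eta>" "\<eta> \<le> 1" "\<eta> \<le> m / (6 * (z - x)^2)" using m zx by (auto simp: \<eta>_def)
  define \<tau> where "\<tau> = \<eta> * min ((x - y)^2) ((z - y)^2) / 3"
  have \<tau>: "0 < \<tau>" using \<eta> xyz by (simp add: \<tau>_def)
  have "\<forall>\<^sub>F \<epsilon> in at_right 0. \<epsilon> + 2 * \<eta> * \<epsilon> < m / 3" using m \<eta> by real_asymp
  then obtain \<epsilon> where e: "0 < \<epsilon>" "\<epsilon> < 1" and E: "E \<epsilon> \<le> \<epsilon>" and small: "\<epsilon> + 2 * \<eta> * \<epsilon> < m / 3"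
    and close: "\<And>w. \<bar>\<phi> \<epsilon> w - g w\<bar> < \<tau>"
    using frequently_ex[OF frequently_eventually_frequently[OF freq
      eventually_conj[OF eventually_in_unit eventually_conj[OF _ eventually_close[OF \<tau>]]]]] by blast
  interpret viscous_hj V "\<phi> \<epsilon>" "p \<epsilon>" "p' \<epsilon>" \<epsilon> "E \<epsilon>" using sol e by blast
  have "3 * \<tau> \<le> \<eta> * (x - y)^2" "3 * \<tau> \<le> \<eta> * (z - y)^2"
    using \<eta> by (auto simp: \<tau>_def intro!: mult_left_mono)
  then have "\<phi> \<epsilon> y < \<phi> \<epsilon> x + \<eta> * (x - y)^2" "\<phi> \<epsilon> y < \<phi> \<epsilon> z + \<eta> * (z - y)^2"
    using close[of x] close[of y] close[of z] le \<tau> by linarith+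
  then obtain t where t: "x < t" "t < z" "V t \<le> 2 * \<eta>\<^sup>2 * (t - y)\<^sup>2 + E \<epsilon> + 2 * \<eta> * \<epsilon>"
    using interior_min[OF xyz, of \<eta>] \<eta> by auto
  have "(t - y)^2 \<le> (z - x)^2" using t xyz by (intro abs_le_square_iff[THEN iffD1]) auto
  moreover have "\<eta>\<^sup>2 \<le> \<eta>" using \<eta> by (simp add: power2_eq_square mult_left_le)
  ultimately have "\<eta>\<^sup>2 * (t - y)^2 \<le> \<eta> * (z - x)^2" using \<eta> by (intro mult_mono) auto
  also have "\<dots> \<le> m / 6" using \<eta>(3) zx by (simp add: field_simps)
  finally have "V t < m" using t(3) E small m by linarith
  then show False using t0(2)[of t] t by (simp add: m_def)
qed

text \<open>The ends may be wells, where V vanishes, so \<open>limit_no_interior_min\<close> is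
  applied on compact subintervals and continuity of \<open>g\<close> recovers the ends.\<close>

lemma limit_strictly_quasiconcave:
  assumes V: "continuous_on UNIV V" "\<And>t. x < t \<Longrightarrow> t < z \<Longrightarrow> 0 < V t"
    and freq: "\<exists>\<^sub>F \<epsilon> in at_right 0. E \<epsilon> \<le> \<epsilon>"
    and xyz: "x < y" "y < z"
  shows "min (g x) (g z) < g y"
proof (rule ccontr)
  assume "\<not> ?thesis"
  then have le: "g y \<le> g x" "g y \<le> g z" by auto
  have core: False if "x < x'" "x' < y'" "y' < z'" "z' < z" "g y' \<le> g x'" "g y' \<le> g z'" for x' y' z'
    using limit_no_interior_min[of x' z' y'] V freq that by auto
  have cont: "(g \<longlongrightarrow> g w) (at w)" for w
    using limit_continuous by (simp add: continuous_on_def)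
  \<comment> \<open>One midpoint must lie strictly below \<open>g y\<close>, hence strictly below
    the neighbouring end. By continuity it is also below some point near that end, so it is a
    forbidden interior minimum.\<close>
  consider "g ((x + y) / 2) < g y" | "g ((y + z) / 2) < g y"
    using core[of "(x + y) / 2" y "(y + z) / 2"] xyz by force
  then show False
  proof cases
    case 1
    then have "\<forall>\<^sub>F w in at_right x. g ((x + y) / 2) < g w"
      using order_tendstoD(1)[OF tendsto_within_subset[OF cont[of x], of "{x<..}"]] le by auto
    then obtain d where d: "x < d" "\<And>w. x < w \<Longrightarrow> w < d \<Longrightarrow> g ((x + y) / 2) < g w"
      by (auto simp: eventually_at_right_field)
    obtain w where "x < w" "w < min d ((x + y) / 2)" using dense[of x "min d ((x + y) / 2)"] d xyz by auto
    then show False using core[of w "(x + y) / 2" y] d(2)[of w] 1 xyz by auto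
  next
    case 2
    then have "\<forall>\<^sub>F w in at_left z. g ((y + z) / 2) < g w"
      using order_tendstoD(1)[OF tendsto_within_subset[OF cont[of z], of "{..<z}"]] le by auto
    then obtain d where d: "d < z" "\<And>w. d < w \<Longrightarrow> w < z \<Longrightarrow> g ((y + z) / 2) < g w"
      by (auto simp: eventually_at_left_field)
    obtain w where "max d ((y + z) / 2) < w" "w < z" using dense[of "max d ((y + z) / 2)" z] d xyz by auto
    then show False using core[of y "(y + z) / 2" w] d(2)[of w] 2 xyz by auto
  qed
qed

end

section \<open>Comparison of the two wells and the contradiction\<close>

lemma Ints_not_between:
  fixes x :: real
  assumes "of_int n < x" "x < of_int n + 1"
  shows "x \<notin> \<int>"
proof
  assume "x \<in> \<int>"
  then obtain k where "x = of_int k" by (auto elim: Ints_cases)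
  then have "n < k" "k < n + 1" using assms by linarith+
  then show False by simp
qed

theorem theorem1p1:
  fixes \<rho> A :: real
    and V V1 V2 V3 :: "real \<Rightarrow> real"
    and c :: "real \<Rightarrow> real"
    and \<phi> \<phi>1 \<phi>2 :: "real \<Rightarrow> real \<Rightarrow> real"
  assumes rho_pos: "0 < \<rho>" and rho_small: "\<rho> < 1/20"
    and A_nz: "A \<noteq> 0" and A_small: "2 * \<bar>A\<bar> * \<rho>^2 \<le> 1/4"
    and V_per: "periodic1 V"
    and V_d1: "\<And>x. (V has_real_derivative V1 x) (at x)"
    and V_d2: "\<And>x. (V1 has_real_derivative V2 x) (at x)"
    and V_d3: "\<And>x. (V2 has_real_derivative V3 x) (at x)"
    and V_C3: "continuous_on UNIV V3"
    and V_near0: "\<And>x. \<bar>x\<bar> < \<rho> \<Longrightarrow> x \<noteq> 0 \<Longrightarrow>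
                    V x = x^2 / 2 + A * x^4 * omega \<bar>x\<bar>"
    and V_0: "V 0 = 0"
    and V_neara: "\<And>x. \<bar>x - 1/2\<bar> < \<rho> \<Longrightarrow> x \<noteq> 1/2 \<Longrightarrow>
                    V x = (x - 1/2)^2 / 2 - A * (x - 1/2)^4 * omega \<bar>x - 1/2\<bar>"
    and V_a: "V (1/2) = 0"
    and V_pos: "\<And>x. x \<notin> \<int> \<Longrightarrow> x - 1/2 \<notin> \<int> \<Longrightarrow> V x > 0"
    and phi_per: "\<And>\<epsilon>. 0 < \<epsilon> \<Longrightarrow> \<epsilon> < 1 \<Longrightarrow> periodic1 (\<phi> \<epsilon>)"
    and phi_d1: "\<And>\<epsilon> x. 0 < \<epsilon> \<Longrightarrow> \<epsilon> < 1 \<Longrightarrow> (\<phi> \<epsilon> has_real_derivative \<phi>1 \<epsilon> x) (at x)"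
    and phi_d2: "\<And>\<epsilon> x. 0 < \<epsilon> \<Longrightarrow> \<epsilon> < 1 \<Longrightarrow> (\<phi>1 \<epsilon> has_real_derivative \<phi>2 \<epsilon> x) (at x)"
    and phi_eq: "\<And>\<epsilon> x. 0 < \<epsilon> \<Longrightarrow> \<epsilon> < 1 \<Longrightarrow>
                   (\<phi>1 \<epsilon> x)^2 / 2 + (- V x) - \<epsilon> * \<phi>2 \<epsilon> x = c \<epsilon>"
    and phi_0: "\<And>\<epsilon>. 0 < \<epsilon> \<Longrightarrow> \<epsilon> < 1 \<Longrightarrow> \<phi> \<epsilon> 0 = 0"
  shows "\<not> (\<exists>g. uniform_limit UNIV \<phi> g (at_right 0))"
proof
  assume "\<exists>g. uniform_limit UNIV \<phi> g (at_right 0)"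
  then obtain g where lim: "uniform_limit UNIV \<phi> g (at_right 0)" by blast
  have cont: "continuous_on UNIV V"
    by (intro continuous_at_imp_continuous_on ballI DERIV_isCont[OF V_d1])
  have V_nonneg: "0 \<le> V x" for x
  proof (cases "x \<in> \<int> \<or> x - 1/2 \<in> \<int>")
    case True
    then obtain k where "x = of_int k \<or> x - 1/2 = of_int k"
      by (metis Ints_cases)
    then have "x = 0 + of_int k \<or> x = 1/2 + of_int k" by linarith
    then have "V x = 0" using periodic1_add_of_int[OF V_per] V_0 V_a by metis
    then show ?thesis by simp
  next
    case False
    then show ?thesis using V_pos[of x] by auto
  qed
  obtain v where v: "\<And>x. V x \<le> V v" using periodic1_attains_sup[OF V_per cont] by blast
  define M where "M = sqrt (2 * V v) + 1"
  have M: "0 < M" using V_nonneg[of v] by (simp add: M_def add_nonneg_pos)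
  have VM: "V x \<le> M\<^sup>2 / 2" for x
  proof -
    have "(sqrt (2 * V v))\<^sup>2 \<le> M\<^sup>2" using V_nonneg[of v] by (intro power_mono) (auto simp: M_def)
    then show ?thesis using v[of x] V_nonneg[of v] by simp
  qed
  have sol: "viscous_hj V (\<phi> \<epsilon>) (\<phi>1 \<epsilon>) (\<phi>2 \<epsilon>) \<epsilon> (- c \<epsilon>)" if "0 < \<epsilon>" "\<epsilon> < 1" for \<epsilon>
  proof
    show "\<epsilon> * \<phi>2 \<epsilon> x = (\<phi>1 \<epsilon> x)\<^sup>2 / 2 - V x + - c \<epsilon>" for x
      using phi_eq[OF that, of x] by linarith
  qed (use that phi_d1 phi_d2 in auto)
  interpret vanishing_viscosity V g "\<lambda>\<epsilon>. - c \<epsilon>" \<phi> \<phi>1 \<phi>2 M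
  proof (rule vanishing_viscosity.intro)
    show "\<bar>\<phi>1 \<epsilon> x\<bar> \<le> M" if "0 < \<epsilon>" "\<epsilon> < 1" for \<epsilon> x
      using viscous_hj.slope_bounded[OF sol[OF that] phi_per[OF that] V_nonneg VM] M by simp
  qed (use sol M lim in auto)
  have w0: "V (0 + x) = x^2 / 2 + A * x^4 * omega \<bar>x\<bar>" if "\<bar>x\<bar> < \<rho>" for x
    using V_near0[OF that] V_0 by (cases "x = 0") auto
  have wa: "V (1/2 + x) = x^2 / 2 - A * x^4 * omega \<bar>x\<bar>" if "\<bar>x\<bar> < \<rho>" for x
    using V_neara[of "1/2 + x"] that V_a by (cases "x = 0") auto
  have "\<exists>\<^sub>F \<epsilon> in at_right 0. - c \<epsilon> \<le> \<epsilon> - \<bar>A\<bar> / 4 * \<epsilon>^2"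
    using resonance[OF A_nz rho_pos w0] by (rule frequently_elim1) auto
  then have freq: "\<exists>\<^sub>F \<epsilon> in at_right 0. - c \<epsilon> \<le> \<epsilon>"
  proof (rule frequently_elim1)
    fix \<epsilon>
    assume "- c \<epsilon> \<le> \<epsilon> - \<bar>A\<bar> / 4 * \<epsilon>^2"
    moreover have "0 \<le> \<bar>A\<bar> / 4 * \<epsilon>^2" by simp
    ultimately show "- c \<epsilon> \<le> \<epsilon>" by linarith
  qed
  have pos: "0 < V t" if "- (1/2) < t \<and> t < 0 \<or> 0 < t \<and> t < 1/2 \<or> 1/2 < t \<and> t < 1" for t
    using that Ints_not_between[of "-1" t] Ints_not_between[of 0 t]
      Ints_not_between[of "-1" "t - 1/2"] Ints_not_between[of 0 "t - 1/2"]
    by (intro V_pos) auto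
  define r where "r = \<rho> / 2"
  have r: "0 < r" "r < \<rho>" "r < 1/2" using rho_pos rho_small by (auto simp: r_def)
  have gper: "g (x + 1) = g x" for x using limit_periodic[OF phi_per] by (simp add: periodic1_def)
  \<comment> \<open>The three intervals join consecutive wells, on both sides of 0 and of
    1/2.\<close>
  have qc: "min (g x) (g z) < g y"
    if "x < y" "y < z" "(x, z) \<in> {(- (1/2), 0), (0, 1/2), (1/2, 1)}" for x y z
    by (rule limit_strictly_quasiconcave[OF cont _ freq that(1,2)]) (use pos that(3) in auto)
  \<comment> \<open>Well 0 is favoured here. A point next to 1/2 where \<open>g\<close> is not
    larger must by \<open>qc\<close> exceed the smaller end value, which is then the value at 0 or
    at its translate 1.\<close>
  have "g (1/2 + r) \<le> g (1/2) \<or> g (1/2 - r) \<le> g (1/2)"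
    by (rule no_local_min_at_other_well[OF A_nz rho_pos _ A_small w0 wa r(1,2)])
       (use rho_small in simp)
  then have "g 0 < g (1/2)"
    using qc[of "1/2" "1/2 + r" 1] qc[of 0 "1/2 - r" "1/2"] gper[of 0] r by auto
  \<comment> \<open>The wells exchange roles along the viscosities resonant with the opposite
    sign.\<close>
  moreover have "g (0 + r) \<le> g 0 \<or> g (0 - r) \<le> g 0"
    by (rule no_local_min_at_other_well[where B = "- A" and b = "1/2", OF _ rho_pos _ _ _ _ r(1,2)])
       (use rho_small A_nz A_small w0 wa in auto)
  then have "g (1/2) < g 0"
    using qc[of 0 r "1/2"] qc[of "- (1/2)" "- r" 0] gper[of "- (1/2)"] r by auto
  ultimately show False by simp
qed

end
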